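(* Let $n\ge1$ and let $(A_k)_{k\in\mathbb{N}}$ be a sequence of subsets of $\mathbb{R}^n$. Then $$\dim_{\mathcal{H}}\Big(\bigcup_{k}A_k\Big)=\sup\{\dim_{\mathcal{H}}(A_k):k\in\mathbb{N}\}.$$
   Context: Hausdorff measure on $\mathbb{R}^n$ (Euclidean distance): for $A\subset\mathbb{R}^n$, $s\ge 0$ and $\epsilon>0$, let $\mathcal{R}_\epsilon(A)$ be the set of countable (finite or infinite) coverings of $A$ by subsets $X\subset\mathbb{R}^n$ with $\mathrm{diam}(X)\le\epsilon$, and put $$\mathcal{H}^s_\epsilon(A)=\inf_{D\in\mathcal{R}_\epsilon(A)}\sum_{X\in D}(\mathrm{diam}(X))^s,\qquad \mathcal{H}^s(A)=\lim_{\epsilon\to0}\mathcal{H}^s_\epsilon(A)=\sup_{\epsilon>0}\mathcal{H}^s_\epsilon(A).$$ For $s=0$, $(\mathrm{diam}(X))^0$ is $1$ if $X\ne\varnothing$ and $0$ if $X=\varnothing$. Hausdorff dimension: $\dim_{\mathcal{H}}(A)=\sup\{s\ge0:\mathcal{H}^s(A)=+\infty\}=\inf\{s\ge0:\mathcal{H}^s(A)=0\}$ (with $\sup\varnothing=0$). *)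

theory Defs
  imports "HOL-Analysis.Analysis"
begin

text \<open>\<^const>\<open>diameter\<close> is real-valued and carries no information on unbounded sets, whose
  diameter is infinite; so \<open>diam X \<le> \<epsilon>\<close> is rendered as \<^term>\<open>bounded X \<and> diameter X \<le> \<epsilon>\<close>.\<close>

definition hausdorff_covers :: "real \<Rightarrow> 'a::metric_space set \<Rightarrow> 'a set set set" where
  "hausdorff_covers \<epsilon> A =
     {D. countable D \<and> A \<subseteq> \<Union>D \<and> (\<forall>X\<in>D. bounded X \<and> diameter X \<le> \<epsilon>)}"

text \<open>The case \<open>s = 0\<close> is separate because \<^prop>\<open>(0::real) powr 0 = 0\<close>, whereas a one-point set
  must get weight \<open>1\<close>. Only bounded sets are ever given a weight below.\<close>

definition diam_pow :: "real \<Rightarrow> 'a::metric_space set \<Rightarrow> ennreal" where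
  "diam_pow s X =
     (if s = 0 then (if X = {} then 0 else 1) else ennreal (diameter X powr s))"

definition hausdorff_premeasure :: "real \<Rightarrow> real \<Rightarrow> 'a::metric_space set \<Rightarrow> ennreal" where
  "hausdorff_premeasure s \<epsilon> A = (INF D\<in>hausdorff_covers \<epsilon> A. \<Sum>\<^sub>\<infinity>X\<in>D. diam_pow s X)"

definition hausdorff_measure :: "real \<Rightarrow> 'a::metric_space set \<Rightarrow> ennreal" where
  "hausdorff_measure s A = (SUP \<epsilon>\<in>{0<..}. hausdorff_premeasure s \<epsilon> A)"

text \<open>In \<^typ>\<open>ennreal\<close> the supremum of the empty set is \<open>0\<close>, as the definition requires.\<close>

definition hausdorff_dim :: "'a::metric_space set \<Rightarrow> ennreal" where
  "hausdorff_dim A = (SUP s\<in>{s. 0 \<le> s \<and> hausdorff_measure s A = \<infinity>}. ennreal s)"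

end

theory Submission
  imports Defs
begin

text \<open>
  Monotonicity of the Hausdorff measures in the set gives \<open>\<ge>\<close>. For \<open>\<le>\<close>, suppose that
  \<open>\<H>\<^sup>s(\<Union>k. A k) = \<infinity>\<close> although \<open>s\<close> exceeds the supremum of the dimensions, and choose a real
  \<open>t\<close> strictly between the two. Every \<open>A k\<close> has dimension below \<open>t\<close>, so \<open>\<H>\<^sup>t(A k)\<close> is finite,
  and the measure drops to zero at any larger exponent: \<open>\<H>\<^sup>s(A k) = 0\<close>
  (\<open>hausdorff_measure_eq_0_of_less\<close>). Countable unions of null sets are null
  (\<open>hausdorff_measure_UN_eq_0\<close>), so \<open>\<H>\<^sup>s(\<Union>k. A k) = 0\<close>, a contradiction.

  The intermediate exponent makes the case distinction at exponent \<open>0\<close> harmless: \<open>t\<close> lies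
  strictly above a nonnegative quantity, so both \<open>s\<close> and \<open>t\<close> are positive when the two
  measures are compared.
\<close>

lemma infsum_ennreal_le:
  fixes f :: "'a \<Rightarrow> ennreal"
  assumes "\<And>F. finite F \<Longrightarrow> F \<subseteq> A \<Longrightarrow> sum f F \<le> b"
  shows "infsum f A \<le> b"
  by (rule infsum_le_finite_sums) (simp_all add: assms nonneg_summable_on_complete)

lemma sum_le_infsum_ennreal:
  fixes f :: "'a \<Rightarrow> ennreal"
  assumes "finite F" "F \<subseteq> A"
  shows "sum f F \<le> infsum f A"
  using assms by (subst nonneg_infsum_complete) (auto intro!: SUP_upper)

text \<open>The sets \<open>D k\<close> may overlap; an element of several of them is charged to only one index,
  and the other occurrences only increase the right-hand side.\<close>

lemma infsum_UN_le_suminf_ennreal: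
  fixes f :: "'a \<Rightarrow> ennreal" and D :: "nat \<Rightarrow> 'a set"
  shows "infsum f (\<Union>k. D k) \<le> (\<Sum>k. infsum f (D k))"
proof (rule infsum_ennreal_le)
  fix F assume F: "finite F" "F \<subseteq> (\<Union>k. D k)"
  then have "\<forall>x\<in>F. \<exists>k. x \<in> D k" by auto
  then obtain idx where idx: "\<And>x. x \<in> F \<Longrightarrow> x \<in> D (idx x)" by metis
  have "sum f F = (\<Sum>k\<in>idx ` F. sum f {x\<in>F. idx x = k})"
    using F(1) by (rule sum.image_gen)
  also have "\<dots> \<le> (\<Sum>k\<in>idx ` F. infsum f (D k))"
    using F(1) by (intro sum_mono sum_le_infsum_ennreal) (auto dest: idx)
  also have "\<dots> \<le> (\<Sum>k. infsum f (D k))"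
    using F(1) by (intro sum_le_suminf) auto
  finally show "sum f F \<le> (\<Sum>k. infsum f (D k))" .
qed

lemma hausdorff_measure_mono:
  assumes "A \<subseteq> B"
  shows "hausdorff_measure s A \<le> hausdorff_measure s B"
  unfolding hausdorff_measure_def hausdorff_premeasure_def
  using assms by (intro SUP_mono' INF_superset_mono) (auto simp: hausdorff_covers_def)

lemma hausdorff_dim_mono:
  assumes "A \<subseteq> B"
  shows "hausdorff_dim A \<le> hausdorff_dim B"
  unfolding hausdorff_dim_def
proof (rule SUP_subset_mono)
  show "{s. 0 \<le> s \<and> hausdorff_measure s A = \<infinity>} \<subseteq> {s. 0 \<le> s \<and> hausdorff_measure s B = \<infinity>}"
    using hausdorff_measure_mono[OF assms] by (metis (mono_tags, lifting) Collect_mono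
      infinity_ennreal_def top_unique)
qed simp

lemma hausdorff_premeasure_antimono:
  assumes "\<delta> \<le> \<epsilon>"
  shows "hausdorff_premeasure s \<epsilon> A \<le> hausdorff_premeasure s \<delta> A"
  unfolding hausdorff_premeasure_def
  using assms by (intro INF_superset_mono) (auto simp: hausdorff_covers_def)

lemma hausdorff_premeasure_le_measure:
  assumes "0 < \<epsilon>"
  shows "hausdorff_premeasure s \<epsilon> A \<le> hausdorff_measure s A"
  unfolding hausdorff_measure_def using assms by (intro SUP_upper) auto

lemma hausdorff_premeasure_le_cover:
  assumes "D \<in> hausdorff_covers \<epsilon> A"
  shows "hausdorff_premeasure s \<epsilon> A \<le> (\<Sum>\<^sub>\<infinity>X\<in>D. diam_pow s X)"
  unfolding hausdorff_premeasure_def using assms by (rule INF_lower)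

lemma hausdorff_premeasure_less_obtains_cover:
  assumes "hausdorff_premeasure s \<epsilon> A < c"
  obtains D where "D \<in> hausdorff_covers \<epsilon> A" "(\<Sum>\<^sub>\<infinity>X\<in>D. diam_pow s X) < c"
  using assms unfolding hausdorff_premeasure_def INF_less_iff by blast

lemma diam_pow_le_mult:
  fixes X :: "'a::metric_space set"
  assumes "0 < t" "t < s" "bounded X" "diameter X \<le> \<delta>"
  shows "diam_pow s X \<le> ennreal (\<delta> powr (s - t)) * diam_pow t X"
proof -
  have d: "0 \<le> diameter X"
    using assms(3) by (rule diameter_ge_0)
  have "diameter X powr s = diameter X powr (s - t) * diameter X powr t"
    by (simp flip: powr_add)
  also have "\<dots> \<le> \<delta> powr (s - t) * diameter X powr t"
    using assms d by (intro mult_right_mono powr_mono2) auto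
  finally show ?thesis
    using assms by (simp add: diam_pow_def ennreal_mult[symmetric] ennreal_leI)
qed

text \<open>By the previous bound, a \<open>\<delta>\<close>-cover whose \<open>t\<close>-sum is below a constant \<open>m\<close> has \<open>s\<close>-sum at
  most \<open>\<delta>\<close> to the power \<open>s - t\<close> times \<open>m\<close>. If \<open>\<H>\<^sup>t(A)\<close> is finite then \<open>m\<close> can be chosen
  independently of \<open>\<delta>\<close>, and the bound tends to zero with \<open>\<delta>\<close>.\<close>

lemma hausdorff_measure_eq_0_of_less:
  fixes A :: "'a::metric_space set"
  assumes "0 < t" "t < s" and fin: "hausdorff_measure t A \<noteq> \<infinity>"
  shows "hausdorff_measure s A = 0"
proof -
  obtain M where M: "0 \<le> M" "hausdorff_measure t A = ennreal M"
    using fin by (cases "hausdorff_measure t A") auto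
  define m where "m = M + 1"
  have less_m: "hausdorff_measure t A < ennreal m"
    using M by (simp add: m_def ennreal_lessI)
  have le: "hausdorff_premeasure s \<delta> A \<le> ennreal (\<delta> powr (s - t) * m)" if "0 < \<delta>" for \<delta>
  proof -
    have "hausdorff_premeasure t \<delta> A < ennreal m"
      using hausdorff_premeasure_le_measure[OF that] less_m by (rule le_less_trans)
    then obtain D where D: "D \<in> hausdorff_covers \<delta> A" "(\<Sum>\<^sub>\<infinity>X\<in>D. diam_pow t X) < ennreal m"
      by (rule hausdorff_premeasure_less_obtains_cover)
    have "(\<Sum>\<^sub>\<infinity>X\<in>D. diam_pow s X) \<le> ennreal (\<delta> powr (s - t)) * ennreal m"
    proof (rule infsum_ennreal_le)
      fix F assume F: "finite F" "F \<subseteq> D"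
      have "sum (diam_pow s) F \<le> (\<Sum>X\<in>F. ennreal (\<delta> powr (s - t)) * diam_pow t X)"
        using D(1) F assms by (intro sum_mono diam_pow_le_mult) (auto simp: hausdorff_covers_def)
      also have "\<dots> = ennreal (\<delta> powr (s - t)) * sum (diam_pow t) F"
        by (simp add: sum_distrib_left)
      also have "\<dots> \<le> ennreal (\<delta> powr (s - t)) * ennreal m"
        using order_trans[OF sum_le_infsum_ennreal[OF F] less_imp_le[OF D(2)]]
        by (rule mult_left_mono) simp
      finally show "sum (diam_pow s) F \<le> ennreal (\<delta> powr (s - t)) * ennreal m" .
    qed
    with hausdorff_premeasure_le_cover[OF D(1), of s]
    have "hausdorff_premeasure s \<delta> A \<le> ennreal (\<delta> powr (s - t)) * ennreal m"
      by (rule order_trans)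
    then show ?thesis
      using M(1) by (simp only: m_def ennreal_mult powr_ge_zero add_nonneg_nonneg zero_le_one)
  qed
  have "hausdorff_premeasure s \<epsilon> A \<le> 0" if "0 < \<epsilon>" for \<epsilon>
  proof (rule tendsto_lowerbound)
    have "((\<lambda>\<delta>. \<delta> powr (s - t)) \<longlongrightarrow> 0) (at_right 0)"
      using assms by (intro tendsto_zero_powrI[where b = "s - t"])
        (auto simp: eventually_at_filter)
    then have "((\<lambda>\<delta>. \<delta> powr (s - t) * m) \<longlongrightarrow> 0) (at_right 0)"
      by (rule tendsto_mult_left_zero)
    then show "((\<lambda>\<delta>. ennreal (\<delta> powr (s - t) * m)) \<longlongrightarrow> 0) (at_right 0)"
      by (auto dest: tendsto_ennrealI)
    have "\<forall>\<^sub>F \<delta> in at_right 0. \<delta> \<in> {0<..<\<epsilon>}"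
      using that by (rule eventually_at_right_real)
    then show "\<forall>\<^sub>F \<delta> in at_right 0. hausdorff_premeasure s \<epsilon> A \<le> ennreal (\<delta> powr (s - t) * m)"
    proof eventually_elim
      case (elim \<delta>)
      then have "hausdorff_premeasure s \<epsilon> A \<le> hausdorff_premeasure s \<delta> A"
        by (intro hausdorff_premeasure_antimono) auto
      also have "\<dots> \<le> ennreal (\<delta> powr (s - t) * m)"
        using elim by (intro le) auto
      finally show ?case .
    qed
  qed simp
  then show ?thesis
    unfolding hausdorff_measure_def by (intro order_antisym SUP_least) auto
qed

text \<open>Merging covers of \<open>A k\<close> of weight below \<open>e * (1/2) ^ Suc k\<close> gives a cover of the union of
  weight at most \<open>e\<close>.\<close>

lemma hausdorff_measure_UN_eq_0:
  fixes A :: "nat \<Rightarrow> 'a::metric_space set"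
  assumes "\<And>k. hausdorff_measure s (A k) = 0"
  shows "hausdorff_measure s (\<Union>k. A k) = 0"
proof -
  have "hausdorff_premeasure s \<epsilon> (\<Union>k. A k) \<le> 0" if "0 < \<epsilon>" for \<epsilon>
  proof (rule ennreal_le_epsilon)
    fix e :: real assume e: "0 < e"
    have "\<exists>D. D \<in> hausdorff_covers \<epsilon> (A k) \<and>
        (\<Sum>\<^sub>\<infinity>X\<in>D. diam_pow s X) < ennreal (e * (1/2) ^ Suc k)" for k
    proof -
      have "hausdorff_premeasure s \<epsilon> (A k) \<le> 0"
        using hausdorff_premeasure_le_measure[OF that, of s "A k"] assms by simp
      also have "0 < ennreal (e * (1/2) ^ Suc k)"
        using e by simp
      finally show ?thesis
        by (metis hausdorff_premeasure_less_obtains_cover)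
    qed
    then obtain D where D: "\<And>k. D k \<in> hausdorff_covers \<epsilon> (A k)"
      "\<And>k. (\<Sum>\<^sub>\<infinity>X\<in>D k. diam_pow s X) < ennreal (e * (1/2) ^ Suc k)"
      by metis
    have "(\<Union>k. D k) \<in> hausdorff_covers \<epsilon> (\<Union>k. A k)"
      using D(1) by (fastforce simp: hausdorff_covers_def)
    then have "hausdorff_premeasure s \<epsilon> (\<Union>k. A k) \<le> (\<Sum>\<^sub>\<infinity>X\<in>(\<Union>k. D k). diam_pow s X)"
      by (rule hausdorff_premeasure_le_cover)
    also have "\<dots> \<le> (\<Sum>k. \<Sum>\<^sub>\<infinity>X\<in>D k. diam_pow s X)"
      by (rule infsum_UN_le_suminf_ennreal)
    also have "\<dots> \<le> (\<Sum>k. ennreal (e * (1/2) ^ Suc k))"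
      using D(2) by (intro suminf_le) (auto intro: less_imp_le)
    also have "\<dots> = ennreal e"
      using e sums_mult[OF power_half_series, of e] by (intro suminf_ennreal_eq) auto
    finally show "hausdorff_premeasure s \<epsilon> (\<Union>k. A k) \<le> 0 + ennreal e"
      by simp
  qed
  then show ?thesis
    unfolding hausdorff_measure_def by (intro order_antisym SUP_least) auto
qed

lemma hausdorff_measure_finite_if_dim_less:
  assumes "hausdorff_dim A < ennreal t" "0 \<le> t"
  shows "hausdorff_measure t A \<noteq> \<infinity>"
proof
  assume "hausdorff_measure t A = \<infinity>"
  then have "ennreal t \<le> hausdorff_dim A"
    unfolding hausdorff_dim_def using assms(2) by (intro SUP_upper) auto
  with assms(1) show False by simp
qed

theorem proposition9:
  fixes A :: "nat \<Rightarrow> (real ^ 'n) set"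
  shows "hausdorff_dim (\<Union>k. A k) = (SUP k. hausdorff_dim (A k))"
proof (rule order_antisym)
  show "(SUP k. hausdorff_dim (A k)) \<le> hausdorff_dim (\<Union>k. A k)"
    by (intro SUP_least hausdorff_dim_mono) auto
  show "hausdorff_dim (\<Union>k. A k) \<le> (SUP k. hausdorff_dim (A k))"
    unfolding hausdorff_dim_def[of "\<Union>k. A k"]
  proof (rule SUP_least, rule ccontr)
    fix s assume s: "s \<in> {s. 0 \<le> s \<and> hausdorff_measure s (\<Union>k. A k) = \<infinity>}"
      and "\<not> ennreal s \<le> (SUP k. hausdorff_dim (A k))"
    then have "(SUP k. hausdorff_dim (A k)) < ennreal s"
      by simp
    then obtain u where u: "(SUP k. hausdorff_dim (A k)) < u" "u < ennreal s"
      using dense by blast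
    define t where "t = enn2real u"
    have u_eq: "u = ennreal t"
      using less_trans[OF u(2) ennreal_less_top] by (simp add: t_def)
    have t: "0 < t"
      using u(1) u_eq by (metis ennreal_less_zero_iff zero_le le_less_trans)
    have ts: "t < s"
      using u(2) s by (simp add: u_eq ennreal_less_iff t less_imp_le)
    have "hausdorff_measure s (A k) = 0" for k
    proof -
      have "hausdorff_dim (A k) \<le> (SUP k. hausdorff_dim (A k))"
        by (rule SUP_upper) simp
      also have "\<dots> < ennreal t"
        using u(1) by (simp only: u_eq)
      finally have "hausdorff_dim (A k) < ennreal t" .
      then have "hausdorff_measure t (A k) \<noteq> \<infinity>"
        using t by (intro hausdorff_measure_finite_if_dim_less) auto
      with t ts show ?thesis
        by (rule hausdorff_measure_eq_0_of_less)
    qed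
    then have "hausdorff_measure s (\<Union>k. A k) = 0"
      by (rule hausdorff_measure_UN_eq_0)
    with s show False by simp
  qed
qed

end
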